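(* Let $n\ge 3$ and let $C=[c_{ij}]$ be a complete $n\times n$ pairwise comparisons (PC) matrix, i.e. $c_{ij}\in\mathbb{R}_{+}$ for all $i,j\in\{1,\ldots,n\}$ and $c_{ii}=1$. Then the following are equivalent: (i) there exist pairwise distinct indices $i,j,k\in\{1,\ldots,n\}$ such that $c_{ik}c_{kj}\neq c_{ij}$; (ii) there exist $m\ge 2$ and pairwise distinct indices $i_{1},i_{2},\ldots,i_{m}\in\{1,\ldots,n\}$ such that $c_{i_{1}i_{2}}c_{i_{2}i_{3}}\cdots c_{i_{m-1}i_{m}}\neq c_{i_{1}i_{m}}$.
   Context: A PC matrix $C=[c_{ij}]$ is complete if every entry $c_{ij}$ is a defined positive real number. A triple of entries $(c_{ik},c_{kj},c_{ij})$ with $i,j,k$ pairwise distinct is called a triad; $C$ is called inconsistent in the triad sense if some triad satisfies $c_{ik}c_{kj}\neq c_{ij}$ (condition (i)). The graph $T_C$ of $C$ is the directed graph on vertices $a_1,\ldots,a_n$ with an edge $(a_i,a_j)$ for each $i\ne j$ with $c_{ij}$ defined; a simple cycle $a_{i_1},\ldots,a_{i_m}$ is a sequence of distinct vertices with consecutive edges $(a_{i_1},a_{i_2}),\ldots,(a_{i_{m-1}},a_{i_m})$ and closing edge $(a_{i_m},a_{i_1})$. $C$ is called inconsistent in the cycle sense if some cycle $a_{i_1},\ldots,a_{i_m}$ in $T_C$ satisfies $c_{i_{1}i_{2}}\cdots c_{i_{m-1}i_{m}}\neq c_{i_{1}i_{m}}$; for a complete matrix every sequence of distinct indices forms a cycle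 in $T_C$, giving condition (ii). The theorem states that for complete PC matrices the two notions of inconsistency coincide. *)

theory Defs
  imports "HOL-Analysis.Analysis"
begin

text \<open>
  Reciprocity (\<open>c\<^sub>j\<^sub>i = 1 / c\<^sub>i\<^sub>j\<close>) is not required.
\<close>

definition complete_pc_matrix :: "real ^ 'n ^ 'n \<Rightarrow> bool" where
  "complete_pc_matrix C \<longleftrightarrow> (\<forall>i j. C $ i $ j > 0) \<and> (\<forall>i. C $ i $ i = 1)"

end

theory Submission
  imports Defs
begin

text \<open>A triad is the shortest nontrivial path: going from i through k to j is a sequence with
  m = 3, so an inconsistent triad is already an inconsistent cycle. Conversely, if all triads are
  consistent, any path of distinct vertices can be contracted from its front: once the first m
  vertices have been replaced by the single entry from \<open>s 1\<close> to \<open>s m\<close>, the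
  next factor merges with it through the triad on \<open>s 1\<close>, \<open>s m\<close>,
  \<open>s (Suc m)\<close>. Hence every path product telescopes to the direct entry, which
  \<open>path_prod_eq_if_triads_consistent\<close> proves by induction on m.\<close>

lemma path_prod_eq_if_triads_consistent:
  fixes C :: "real ^ 'n ^ 'n" and s :: "nat \<Rightarrow> 'n"
  assumes triad: "\<And>i j k. i \<noteq> j \<Longrightarrow> j \<noteq> k \<Longrightarrow> i \<noteq> k \<Longrightarrow> C $ i $ k * C $ k $ j = C $ i $ j"
    and "m \<ge> 2" and "inj_on s {1..m}"
  shows "(\<Prod>l\<in>{1..<m}. C $ s l $ s (l + 1)) = C $ s 1 $ s m"
  using assms(2,3)
proof (induction m rule: nat_induct_at_least)
  case base
  have "{1..<2} = {1::nat}" by auto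
  then show ?case by (simp add: numeral_2_eq_2)
next
  case (Suc m)
  have inj: "inj_on s {1..m}"
    using Suc.prems by (rule inj_on_subset) auto
  \<comment> \<open>The third inequality needs m \<noteq> 1; this is why the induction starts at 2,
    where the product is a single entry. The order of the facts matches \<open>triad\<close> with
    intermediate vertex \<open>s m\<close>.\<close>
  have distinct: "s 1 \<noteq> s (Suc m)" "s (Suc m) \<noteq> s m" "s 1 \<noteq> s m"
    using Suc.prems Suc.hyps by (auto dest: inj_onD)
  have "(\<Prod>l\<in>{1..<Suc m}. C $ s l $ s (l + 1))
      = (\<Prod>l\<in>{1..<m}. C $ s l $ s (l + 1)) * C $ s m $ s (Suc m)"
    using Suc.hyps by simp
  also have "\<dots> = C $ s 1 $ s m * C $ s m $ s (Suc m)"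
    by (simp only: Suc.IH[OF inj])
  also have "\<dots> = C $ s 1 $ s (Suc m)"
    by (rule triad[OF distinct])
  finally show ?case .
qed

theorem theorem13:
  fixes C :: "real ^ 'n ^ 'n"
  assumes "CARD('n) \<ge> 3"
    and "complete_pc_matrix C"
  shows "(\<exists>i j k. i \<noteq> j \<and> j \<noteq> k \<and> i \<noteq> k \<and> C $ i $ k * C $ k $ j \<noteq> C $ i $ j) \<longleftrightarrow>
    (\<exists>(m::nat) (s :: nat \<Rightarrow> 'n). m \<ge> 2 \<and> inj_on s {1..m} \<and>
      (\<Prod>l\<in>{1..<m}. C $ s l $ s (l + 1)) \<noteq> C $ s 1 $ s m)"
    (is "?triad \<longleftrightarrow> ?cycle")
proof
  assume ?triad
  then obtain i j k where ijk: "i \<noteq> j" "j \<noteq> k" "i \<noteq> k"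
    and ne: "C $ i $ k * C $ k $ j \<noteq> C $ i $ j"
    by blast
  \<comment> \<open>The path i, k, j: its two factors are the left side of the triad, and its
    endpoints give the entry on the right. Outside \<open>{1..3}\<close> the value j is an arbitrary
    default.\<close>
  define s :: "nat \<Rightarrow> 'n" where "s = (\<lambda>l. if l = 1 then i else if l = 2 then k else j)"
  have sets: "{1..3} = {1, 2, 3::nat}" "{1..<3} = {1, 2::nat}"
    by auto
  have "inj_on s {1..3}"
    unfolding sets using ijk by (auto simp: s_def)
  moreover have "(\<Prod>l\<in>{1..<3}. C $ s l $ s (l + 1)) \<noteq> C $ s 1 $ s 3"
    unfolding sets using ne by (simp add: s_def)
  ultimately show ?cycle
    by (intro exI[of _ 3] exI[of _ s]) simp
next
  assume ?cycle
  then obtain m and s :: "nat \<Rightarrow> 'n" where "m \<ge> 2" "inj_on s {1..m}"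
    and ne: "(\<Prod>l\<in>{1..<m}. C $ s l $ s (l + 1)) \<noteq> C $ s 1 $ s m"
    by blast
  show ?triad
  proof (rule ccontr)
    \<comment> \<open>The negation supplies consistency of every triad, so the path product
      telescopes, against \<open>ne\<close>.\<close>
    assume "\<not> ?triad"
    then have "C $ i $ k * C $ k $ j = C $ i $ j" if "i \<noteq> j" "j \<noteq> k" "i \<noteq> k" for i j k
      using that by blast
    from path_prod_eq_if_triads_consistent[OF this \<open>m \<ge> 2\<close> \<open>inj_on s {1..m}\<close>] ne
    show False by contradiction
  qed
qed

end
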